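(* Let $(\mathfrak g,[\cdot,\cdot,\cdot]_{\mathfrak g})$ be a $3$-Lie algebra, $(V;\rho)$ a representation of $\mathfrak g$, $\Phi$ a $2$-cocycle on $\mathfrak g$ with coefficients in $(V;\rho)$, and let $T:V\to\mathfrak g$ be a $\Phi$-twisted Rota-Baxter operator on $\mathfrak g$ with respect to $(V;\rho)$. If two one-parameter infinitesimal deformations $T^1_t=T+t\mathfrak T_1$ and $T^2_t=T+t\mathfrak T_2$ of $T$ are equivalent, then $\mathfrak T_1$ and $\mathfrak T_2$ are in the same cohomology class in $\mathcal H^2_T(V;\mathfrak g)$.
   Context: All vector spaces are over a fixed field of characteristic different from $2$, and the parameter $t$ ranges over this field. A 3-Lie algebra is a vector space $\mathfrak g$ with a skew-symmetric trilinear map $[\cdot,\cdot,\cdot]_{\mathfrak g}$ (i.e. a linear map $\wedge^3\mathfrak g\to\mathfrak g$) such that for all $x_1,\dots,x_5\in\mathfrak g$: $[x_1,x_2,[x_3,x_4,x_5]_{\mathfrak g}]_{\mathfrak g}=[[x_1,x_2,x_3]_{\mathfrak g},x_4,x_5]_{\mathfrak g}+[x_3,[x_1,x_2,x_4]_{\mathfrak g},x_5]_{\mathfrak g}+[x_3,x_4,[x_1,x_2,x_5]_{\mathfrak g}]_{\mathfrak g}$. A homomorphism of 3-Lie algebras is a linear map preserving the brackets. A representation of $\mathfrak g$ is a pair $(V;\rho)$ with $V$ a vector space and $\rho:\wedge^2\mathfrak g\to\mathfrak{gl}(V)$ linear such that for all $x_1,\dots,x_4\in\mathfrak g$: (i)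 $[\rho(x_1,x_2),\rho(x_3,x_4)]=\rho([x_1,x_2,x_3]_{\mathfrak g},x_4)+\rho(x_3,[x_1,x_2,x_4]_{\mathfrak g})$ (commutator on the left); (ii) $\rho([x_1,x_2,x_3]_{\mathfrak g},x_4)=\rho(x_1,x_2)\rho(x_3,x_4)+\rho(x_2,x_3)\rho(x_1,x_4)+\rho(x_3,x_1)\rho(x_2,x_4)$. A 2-cocycle on $\mathfrak g$ with coefficients in $(V;\rho)$ is a linear map $\Phi:\wedge^3\mathfrak g\to V$ such that for all $x_1,\dots,x_5\in\mathfrak g$: $\Phi(x_1,x_2,[x_3,x_4,x_5]_{\mathfrak g})-\Phi([x_1,x_2,x_3]_{\mathfrak g},x_4,x_5)-\Phi(x_3,[x_1,x_2,x_4]_{\mathfrak g},x_5)-\Phi(x_3,x_4,[x_1,x_2,x_5]_{\mathfrak g})+\rho(x_1,x_2)\Phi(x_3,x_4,x_5)-\rho(x_3,x_4)\Phi(x_1,x_2,x_5)-\rho(x_4,x_5)\Phi(x_1,x_2,x_3)-\rho(x_5,x_3)\Phi(x_1,x_2,x_4)=0$. A $\Phi$-twisted Rota-Baxter operator on $\mathfrak g$ with respect to $(V;\rho)$ is a linear map $T:V\to\mathfrak g$ with $[Tu,Tv,Tw]_{\mathfrak g}=T\big(\rho(Tu,Tv)w+\rho(Tv,Tw)u+\rho(Tw,Tu)v+\Phi(Tu,Tv,Tw)\big)$ for all $u,v,w\in V$. For such $T$, $V$ is a 3-Lie algebra under $[u,v,w]_T=\rho(Tu,Tv)w+\rho(Tv,Tw)u+\rho(Tw,Tu)v+\Phi(Tu,Tv,Tw)$,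 and it has the representation $(\mathfrak g;\varrho)$ with $\varrho(u,v)(x)=[Tu,Tv,x]_{\mathfrak g}-T\big(\rho(x,Tu)v+\rho(Tv,x)u+\Phi(Tu,Tv,x)\big)$. For $\mathfrak X=x\wedge y\in\wedge^2\mathfrak g$ write $\rho(\mathfrak X)=\rho(x,y)$, $\mathrm{ad}_{\mathfrak X}z=[\mathfrak X,z]_{\mathfrak g}=[x,y,z]_{\mathfrak g}$, $\Phi(\mathfrak X,z)=\Phi(x,y,z)$, extended linearly to all $\mathfrak X\in\wedge^2\mathfrak g$; and $\Phi(\mathfrak X,T):V\to V$ is the map $u\mapsto\Phi(\mathfrak X,Tu)$. Cohomology of $T$ in degree 2: the complex has $C^1_T(V;\mathfrak g)=\mathfrak g\wedge\mathfrak g$, $C^2_T(V;\mathfrak g)=\mathrm{Hom}(V,\mathfrak g)$, $C^3_T(V;\mathfrak g)=\mathrm{Hom}(\wedge^3V,\mathfrak g)$, with differential $\partial=\delta$ on $C^1_T$, where $\delta(\mathfrak X)v=T\rho(\mathfrak X)v-[\mathfrak X,Tv]_{\mathfrak g}+T\Phi(\mathfrak X,Tv)$, and $\partial=\mathrm d_T$ on $C^2_T$, where $(\mathrm d_Tf)(u,v,w)=\varrho(u,v)f(w)+\varrho(v,w)f(u)+\varrho(w,u)f(v)-f([u,v,w]_T)$. Then $\mathcal H^2_T(V;\mathfrak g)=\ker(\mathrm d_T|_{C^2_T})/\delta(\mathfrak g\wedge\mathfrak g)$. (If $T+t\mathfrak T$ is a one-parameter infinitesimal deformation of $T$, as defined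 below, then $\mathrm d_T\mathfrak T=0$, so $\mathfrak T$ defines a class in $\mathcal H^2_T(V;\mathfrak g)$.) A homomorphism from a $\Phi$-twisted Rota-Baxter operator $T$ to another one $T'$ (both on $\mathfrak g$ with respect to $(V;\rho)$) is a pair $(\phi,\psi)$ of a 3-Lie algebra homomorphism $\phi:\mathfrak g\to\mathfrak g$ and a linear map $\psi:V\to V$ such that $\phi\circ T=T'\circ\psi$, $\psi(\rho(x,y)u)=\rho(\phi(x),\phi(y))(\psi(u))$ for all $x,y\in\mathfrak g$, $u\in V$, and $\psi\circ\Phi=\Phi\circ(\phi\otimes\phi\otimes\phi)$. For a linear map $\mathfrak T:V\to\mathfrak g$, $T_t=T+t\mathfrak T$ is a one-parameter infinitesimal deformation of $T$ if $T_t$ is a $\Phi$-twisted Rota-Baxter operator on $\mathfrak g$ with respect to $(V;\rho)$ for all $t$. Two one-parameter infinitesimal deformations $T^1_t=T+t\mathfrak T_1$ and $T^2_t=T+t\mathfrak T_2$ are equivalent if there exists $\mathfrak X\in\mathfrak g\wedge\mathfrak g$ such that $(\mathrm{Id}_{\mathfrak g}+t\,\mathrm{ad}_{\mathfrak X},\ \mathrm{Id}_V+t\rho(\mathfrak X)+t\Phi(\mathfrak X,T))$ is a homomorphism from $T^1_t$ to $T^2_t$ (for all $t$).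
   Formalization: Over the field with three elements the two directions need not be cocycles, so there only the statement that their difference lies in δ(g∧g) is proved; over all other fields of characteristic ≠ 2 both are shown to lie in a common class of H²_T. *)

theory Defs
  imports
    "HOL-Library.Poly_Mapping"
    "HOL-Computational_Algebra.Computational_Algebra"
begin

text \<open>
  Vector spaces are types of class \<^class>\<open>ab_group_add\<close> with an explicit scalar multiplication
  satisfying \<^locale>\<open>vector_space\<close>. Throughout, \<open>sg\<close> and \<open>sv\<close> are the scalar multiplications of
  the 3-Lie algebra and of the representation space, \<open>br\<close> is the bracket.
\<close>

section \<open>3-Lie algebras, representations, 2-cocycles\<close>

text \<open>
  Linear maps out of the exterior square or cube of a space are represented by skew-symmetric
  multilinear functions. Skew-symmetry and alternation agree because the characteristic is
  not 2.
\<close>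

definition skew_bilinear ::
  "('k::field \<Rightarrow> 'a::ab_group_add \<Rightarrow> 'a) \<Rightarrow> ('k \<Rightarrow> 'b::ab_group_add \<Rightarrow> 'b) \<Rightarrow> ('a \<Rightarrow> 'a \<Rightarrow> 'b) \<Rightarrow> bool"
  where "skew_bilinear s s' B \<longleftrightarrow>
    (\<forall>y. Vector_Spaces.linear s s' (\<lambda>x. B x y)) \<and>
    (\<forall>x. Vector_Spaces.linear s s' (\<lambda>y. B x y)) \<and>
    (\<forall>x y. B y x = - B x y)"

definition skew_trilinear ::
  "('k::field \<Rightarrow> 'a::ab_group_add \<Rightarrow> 'a) \<Rightarrow> ('k \<Rightarrow> 'b::ab_group_add \<Rightarrow> 'b) \<Rightarrow>
    ('a \<Rightarrow> 'a \<Rightarrow> 'a \<Rightarrow> 'b) \<Rightarrow> bool"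
  where "skew_trilinear s s' F \<longleftrightarrow>
    (\<forall>y z. Vector_Spaces.linear s s' (\<lambda>x. F x y z)) \<and>
    (\<forall>x z. Vector_Spaces.linear s s' (\<lambda>y. F x y z)) \<and>
    (\<forall>x y. Vector_Spaces.linear s s' (\<lambda>z. F x y z)) \<and>
    (\<forall>x y z. F y x z = - F x y z) \<and>
    (\<forall>x y z. F x z y = - F x y z)"

locale three_lie_algebra = vector_space sg
  for sg :: "'k::field \<Rightarrow> 'g::ab_group_add \<Rightarrow> 'g"
    and br :: "'g \<Rightarrow> 'g \<Rightarrow> 'g \<Rightarrow> 'g" +
  assumes skew_trilinear_bracket: "skew_trilinear sg sg br"
    and fundamental_identity:
      "br x1 x2 (br x3 x4 x5) =
         br (br x1 x2 x3) x4 x5 + br x3 (br x1 x2 x4) x5 + br x3 x4 (br x1 x2 x5)"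

locale three_lie_representation =
  three_lie_algebra sg br + V: vector_space sv
  for sg :: "'k::field \<Rightarrow> 'g::ab_group_add \<Rightarrow> 'g"
    and br :: "'g \<Rightarrow> 'g \<Rightarrow> 'g \<Rightarrow> 'g"
    and sv :: "'k \<Rightarrow> 'v::ab_group_add \<Rightarrow> 'v"
    and \<rho> :: "'g \<Rightarrow> 'g \<Rightarrow> 'v \<Rightarrow> 'v" +
  assumes rho_linear: "Vector_Spaces.linear sv sv (\<rho> x y)"
    and rho_skew_bilinear: "skew_bilinear sg sv (\<lambda>x y. \<rho> x y u)"
    and rho_commutator:
      "\<rho> x1 x2 (\<rho> x3 x4 u) - \<rho> x3 x4 (\<rho> x1 x2 u) =
         \<rho> (br x1 x2 x3) x4 u + \<rho> x3 (br x1 x2 x4) u"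
    and rho_bracket:
      "\<rho> (br x1 x2 x3) x4 u =
         \<rho> x1 x2 (\<rho> x3 x4 u) + \<rho> x2 x3 (\<rho> x1 x4 u) + \<rho> x3 x1 (\<rho> x2 x4 u)"

definition two_cocycle ::
  "('k::field \<Rightarrow> 'g::ab_group_add \<Rightarrow> 'g) \<Rightarrow> ('g \<Rightarrow> 'g \<Rightarrow> 'g \<Rightarrow> 'g) \<Rightarrow>
    ('k \<Rightarrow> 'v::ab_group_add \<Rightarrow> 'v) \<Rightarrow> ('g \<Rightarrow> 'g \<Rightarrow> 'v \<Rightarrow> 'v) \<Rightarrow>
    ('g \<Rightarrow> 'g \<Rightarrow> 'g \<Rightarrow> 'v) \<Rightarrow> bool"
  where "two_cocycle sg br sv \<rho> \<Phi> \<longleftrightarrow>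
    skew_trilinear sg sv \<Phi> \<and>
    (\<forall>x1 x2 x3 x4 x5.
       \<Phi> x1 x2 (br x3 x4 x5) - \<Phi> (br x1 x2 x3) x4 x5
       - \<Phi> x3 (br x1 x2 x4) x5 - \<Phi> x3 x4 (br x1 x2 x5)
       + \<rho> x1 x2 (\<Phi> x3 x4 x5) - \<rho> x3 x4 (\<Phi> x1 x2 x5)
       - \<rho> x4 x5 (\<Phi> x1 x2 x3) - \<rho> x5 x3 (\<Phi> x1 x2 x4) = 0)"

section \<open>The exterior square\<close>

text \<open>
  The exterior square of \<open>'g\<close> is the free vector space on \<open>'g \<times> 'g\<close> modulo the subspace generated
  by the bilinearity relations and the pairs \<open>(x, x)\<close>. Its elements are cosets, that is, sets of
  elements of the free vector space.
\<close>

definition free_scale :: "'k::field \<Rightarrow> ('b \<Rightarrow>\<^sub>0 'k) \<Rightarrow> ('b \<Rightarrow>\<^sub>0 'k)"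
  where "free_scale c = Poly_Mapping.map (\<lambda>a. c * a)"

definition ext2_relations ::
  "('k::field \<Rightarrow> 'g::ab_group_add \<Rightarrow> 'g) \<Rightarrow> (('g \<times> 'g) \<Rightarrow>\<^sub>0 'k) set"
  where "ext2_relations sg =
    {Poly_Mapping.single (x + x', y) 1 - Poly_Mapping.single (x, y) 1
       - Poly_Mapping.single (x', y) 1 | x x' y. True} \<union>
    {Poly_Mapping.single (x, y + y') 1 - Poly_Mapping.single (x, y) 1
       - Poly_Mapping.single (x, y') 1 | x y y'. True} \<union>
    {Poly_Mapping.single (sg c x, y) 1 - Poly_Mapping.single (x, y) c | c x y. True} \<union>
    {Poly_Mapping.single (x, sg c y) 1 - Poly_Mapping.single (x, y) c | c x y. True} \<union>
    {Poly_Mapping.single (x, x) 1 | x. True}"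

definition ext2_rel ::
  "('k::field \<Rightarrow> 'g::ab_group_add \<Rightarrow> 'g) \<Rightarrow>
    ((('g \<times> 'g) \<Rightarrow>\<^sub>0 'k) \<times> (('g \<times> 'g) \<Rightarrow>\<^sub>0 'k)) set"
  where "ext2_rel sg = {(f, h). f - h \<in> module.span free_scale (ext2_relations sg)}"

definition ext2 ::
  "('k::field \<Rightarrow> 'g::ab_group_add \<Rightarrow> 'g) \<Rightarrow> (('g \<times> 'g) \<Rightarrow>\<^sub>0 'k) set set"
  where "ext2 sg = UNIV // ext2_rel sg"

definition wedge ::
  "('k::field \<Rightarrow> 'g::ab_group_add \<Rightarrow> 'g) \<Rightarrow> 'g \<Rightarrow> 'g \<Rightarrow> (('g \<times> 'g) \<Rightarrow>\<^sub>0 'k) set"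
  where "wedge sg x y = ext2_rel sg `` {Poly_Mapping.single (x, y) 1}"

text \<open>
  The linear map on the exterior square induced by a skew-symmetric bilinear \<open>B\<close>. All
  representatives of an element yield the same value, see \<open>ext2_lift_class\<close> below.
\<close>

definition free_lift ::
  "('k::field \<Rightarrow> 'w::ab_group_add \<Rightarrow> 'w) \<Rightarrow> ('g \<Rightarrow> 'g \<Rightarrow> 'w) \<Rightarrow> (('g \<times> 'g) \<Rightarrow>\<^sub>0 'k) \<Rightarrow> 'w"
  where "free_lift s B f =
    (\<Sum>p\<in>Poly_Mapping.keys f. s (Poly_Mapping.lookup f p) (B (fst p) (snd p)))"

definition ext2_lift ::
  "('k::field \<Rightarrow> 'w::ab_group_add \<Rightarrow> 'w) \<Rightarrow> ('g \<Rightarrow> 'g \<Rightarrow> 'w) \<Rightarrow> (('g \<times> 'g) \<Rightarrow>\<^sub>0 'k) set \<Rightarrow> 'w"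
  where "ext2_lift s B X = the_elem (free_lift s B ` X)"

lemma lookup_free_scale [simp]:
  "Poly_Mapping.lookup (free_scale c f) p = c * Poly_Mapping.lookup f p"
  by (simp add: free_scale_def Poly_Mapping.map.rep_eq when_def)

lemma vector_space_free_scale: "vector_space (free_scale :: 'k::field \<Rightarrow> ('b \<Rightarrow>\<^sub>0 'k) \<Rightarrow> _)"
  by unfold_locales (auto intro!: poly_mapping_eqI simp: lookup_add algebra_simps)

lemma free_lift_superset:
  assumes "vector_space s" "finite A" "Poly_Mapping.keys f \<subseteq> A"
  shows "free_lift s B f = (\<Sum>p\<in>A. s (Poly_Mapping.lookup f p) (B (fst p) (snd p)))"
proof -
  interpret vector_space s by fact
  show ?thesis
    unfolding free_lift_def
    by (rule sum.mono_neutral_left) (use assms in \<open>auto simp: in_keys_iff\<close>)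
qed

lemma linear_free_lift:
  fixes s :: "'k::field \<Rightarrow> 'w::ab_group_add \<Rightarrow> 'w"
  assumes "vector_space s"
  shows "Vector_Spaces.linear free_scale s (free_lift s B)"
proof -
  interpret W: vector_space s by fact
  interpret F: vector_space "free_scale :: 'k \<Rightarrow> (('a \<times> 'a) \<Rightarrow>\<^sub>0 'k) \<Rightarrow> _"
    by (rule vector_space_free_scale)
  show ?thesis
  proof unfold_locales
    fix f h :: "('a \<times> 'a) \<Rightarrow>\<^sub>0 'k"
    let ?A = "Poly_Mapping.keys f \<union> Poly_Mapping.keys h"
    have "Poly_Mapping.keys (f + h) \<subseteq> ?A"
      by (rule Poly_Mapping.keys_add)
    then show "free_lift s B (f + h) = free_lift s B f + free_lift s B h"
      using free_lift_superset[OF assms, of ?A "f + h" B]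
        free_lift_superset[OF assms, of ?A f B] free_lift_superset[OF assms, of ?A h B]
      by (simp add: lookup_add W.scale_left_distrib sum.distrib)
  next
    fix c and f :: "('a \<times> 'a) \<Rightarrow>\<^sub>0 'k"
    have "Poly_Mapping.keys (free_scale c f) \<subseteq> Poly_Mapping.keys f"
      by (auto simp: in_keys_iff)
    then show "free_lift s B (free_scale c f) = s c (free_lift s B f)"
      using free_lift_superset[OF assms, of "Poly_Mapping.keys f" "free_scale c f" B]
      by (simp add: free_lift_def W.scale_sum_right)
  qed
qed

lemma free_lift_single:
  assumes "vector_space s"
  shows "free_lift s B (Poly_Mapping.single p c) = s c (B (fst p) (snd p))"
proof -
  interpret vector_space s by fact
  show ?thesis
    using free_lift_superset[OF assms, of "{p}" "Poly_Mapping.single p c" B] by simp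
qed

lemma ext2_lift_class:
  fixes sg :: "'k::field \<Rightarrow> 'g::ab_group_add \<Rightarrow> 'g"
    and s :: "'k \<Rightarrow> 'w::ab_group_add \<Rightarrow> 'w"
  assumes "CHAR('k) \<noteq> 2" "vector_space s" "skew_bilinear sg s B"
  shows "ext2_lift s B (ext2_rel sg `` {f}) = free_lift s B f"
proof -
  interpret W: vector_space s by fact
  interpret F: vector_space "free_scale :: 'k \<Rightarrow> (('g \<times> 'g) \<Rightarrow>\<^sub>0 'k) \<Rightarrow> _"
    by (rule vector_space_free_scale)
  interpret L: Vector_Spaces.linear free_scale s "free_lift s B"
    by (rule linear_free_lift) fact
  have two: "(2::'k) \<noteq> 0"
  proof
    assume "(2::'k) = 0"
    then have "CHAR('k) dvd 2"
      using of_nat_eq_0_iff_char_dvd[where 'a='k, of 2] by simp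
    then have "CHAR('k) = 1"
      using assms(1) by (meson prime_nat_iff two_is_prime_nat)
    then show False by simp
  qed
  have alt: "B x x = 0" for x
  proof -
    have "B x x = - B x x" using assms(3) unfolding skew_bilinear_def by blast
    then have "s 2 (B x x) = 0"
      by (metis W.scale_left_distrib W.scale_one eq_neg_iff_add_eq_0 one_add_one)
    then show ?thesis using two by simp
  qed
  have l: "module_hom sg s (\<lambda>x. B x y)" and r: "module_hom sg s (B x)" for x y
    using assms(3) unfolding skew_bilinear_def Vector_Spaces.linear_def by blast+
  note B_simps = module_hom.add[OF l] module_hom.add[OF r]
    module_hom.scale[OF l] module_hom.scale[OF r]
  have "free_lift s B r = 0" if "r \<in> ext2_relations sg" for r
    using that unfolding ext2_relations_def
    by (elim UnE CollectE exE conjE)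
      (simp_all only: L.diff free_lift_single[OF assms(2)] alt B_simps fst_conv snd_conv
        W.scale_one W.scale_zero_right add_diff_cancel_left' diff_self)
  then have null: "free_lift s B r = 0" if "r \<in> F.span (ext2_relations sg)" for r
    using that L.eq_0_on_span by blast
  have eq: "free_lift s B h = free_lift s B f" if "h \<in> ext2_rel sg `` {f}" for h
    using that null[of "f - h"] by (simp add: ext2_rel_def L.diff)
  have "f \<in> ext2_rel sg `` {f}"
    by (simp add: ext2_rel_def F.span_zero)
  then have "ext2_rel sg `` {f} \<noteq> {}"
    by blast
  then show ?thesis
    unfolding ext2_lift_def by (rule the_elem_image_unique) (rule eq)
qed

lemma ext2_lift_wedge:
  fixes sg :: "'k::field \<Rightarrow> 'g::ab_group_add \<Rightarrow> 'g"
    and s :: "'k \<Rightarrow> 'w::ab_group_add \<Rightarrow> 'w"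
  assumes "CHAR('k) \<noteq> 2" "vector_space s" "skew_bilinear sg s B"
  shows "ext2_lift s B (wedge sg x y) = B x y"
proof -
  interpret vector_space s by fact
  show ?thesis
    by (simp add: wedge_def ext2_lift_class[OF assms] free_lift_single[OF assms(2)])
qed

definition rho_ext ::
  "('k::field \<Rightarrow> 'v::ab_group_add \<Rightarrow> 'v) \<Rightarrow> ('g \<Rightarrow> 'g \<Rightarrow> 'v \<Rightarrow> 'v) \<Rightarrow>
    (('g \<times> 'g) \<Rightarrow>\<^sub>0 'k) set \<Rightarrow> 'v \<Rightarrow> 'v"
  where "rho_ext sv \<rho> X u = ext2_lift sv (\<lambda>x y. \<rho> x y u) X"

definition ad_ext ::
  "('k::field \<Rightarrow> 'g::ab_group_add \<Rightarrow> 'g) \<Rightarrow> ('g \<Rightarrow> 'g \<Rightarrow> 'g \<Rightarrow> 'g) \<Rightarrow>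
    (('g \<times> 'g) \<Rightarrow>\<^sub>0 'k) set \<Rightarrow> 'g \<Rightarrow> 'g"
  where "ad_ext sg br X z = ext2_lift sg (\<lambda>x y. br x y z) X"

definition Phi_ext ::
  "('k::field \<Rightarrow> 'v::ab_group_add \<Rightarrow> 'v) \<Rightarrow> ('g \<Rightarrow> 'g \<Rightarrow> 'g \<Rightarrow> 'v) \<Rightarrow>
    (('g \<times> 'g) \<Rightarrow>\<^sub>0 'k) set \<Rightarrow> 'g \<Rightarrow> 'v"
  where "Phi_ext sv \<Phi> X z = ext2_lift sv (\<lambda>x y. \<Phi> x y z) X"

section \<open>Twisted Rota-Baxter operators and their cohomology\<close>

definition bracket_T ::
  "('g \<Rightarrow> 'g \<Rightarrow> 'v::ab_group_add \<Rightarrow> 'v) \<Rightarrow> ('g \<Rightarrow> 'g \<Rightarrow> 'g \<Rightarrow> 'v) \<Rightarrow> ('v \<Rightarrow> 'g) \<Rightarrow>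
    'v \<Rightarrow> 'v \<Rightarrow> 'v \<Rightarrow> 'v"
  where "bracket_T \<rho> \<Phi> T u v w =
    \<rho> (T u) (T v) w + \<rho> (T v) (T w) u + \<rho> (T w) (T u) v + \<Phi> (T u) (T v) (T w)"

definition twisted_rota_baxter ::
  "('k::field \<Rightarrow> 'g::ab_group_add \<Rightarrow> 'g) \<Rightarrow> ('g \<Rightarrow> 'g \<Rightarrow> 'g \<Rightarrow> 'g) \<Rightarrow>
    ('k \<Rightarrow> 'v::ab_group_add \<Rightarrow> 'v) \<Rightarrow> ('g \<Rightarrow> 'g \<Rightarrow> 'v \<Rightarrow> 'v) \<Rightarrow>
    ('g \<Rightarrow> 'g \<Rightarrow> 'g \<Rightarrow> 'v) \<Rightarrow> ('v \<Rightarrow> 'g) \<Rightarrow> bool"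
  where "twisted_rota_baxter sg br sv \<rho> \<Phi> T \<longleftrightarrow>
    Vector_Spaces.linear sv sg T \<and>
    (\<forall>u v w. br (T u) (T v) (T w) = T (bracket_T \<rho> \<Phi> T u v w))"

definition varrho_T ::
  "('g::ab_group_add \<Rightarrow> 'g \<Rightarrow> 'g \<Rightarrow> 'g) \<Rightarrow> ('g \<Rightarrow> 'g \<Rightarrow> 'v::ab_group_add \<Rightarrow> 'v) \<Rightarrow>
    ('g \<Rightarrow> 'g \<Rightarrow> 'g \<Rightarrow> 'v) \<Rightarrow> ('v \<Rightarrow> 'g) \<Rightarrow> 'v \<Rightarrow> 'v \<Rightarrow> 'g \<Rightarrow> 'g"
  where "varrho_T br \<rho> \<Phi> T u v x =
    br (T u) (T v) x - T (\<rho> x (T u) v + \<rho> (T v) x u + \<Phi> (T u) (T v) x)"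

definition d_T ::
  "('g::ab_group_add \<Rightarrow> 'g \<Rightarrow> 'g \<Rightarrow> 'g) \<Rightarrow> ('g \<Rightarrow> 'g \<Rightarrow> 'v::ab_group_add \<Rightarrow> 'v) \<Rightarrow>
    ('g \<Rightarrow> 'g \<Rightarrow> 'g \<Rightarrow> 'v) \<Rightarrow> ('v \<Rightarrow> 'g) \<Rightarrow> ('v \<Rightarrow> 'g) \<Rightarrow> 'v \<Rightarrow> 'v \<Rightarrow> 'v \<Rightarrow> 'g"
  where "d_T br \<rho> \<Phi> T f u v w =
    varrho_T br \<rho> \<Phi> T u v (f w) + varrho_T br \<rho> \<Phi> T v w (f u) + varrho_T br \<rho> \<Phi> T w u (f v)
    - f (bracket_T \<rho> \<Phi> T u v w)"

definition delta_T ::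
  "('k::field \<Rightarrow> 'g::ab_group_add \<Rightarrow> 'g) \<Rightarrow> ('g \<Rightarrow> 'g \<Rightarrow> 'g \<Rightarrow> 'g) \<Rightarrow>
    ('k \<Rightarrow> 'v::ab_group_add \<Rightarrow> 'v) \<Rightarrow> ('g \<Rightarrow> 'g \<Rightarrow> 'v \<Rightarrow> 'v) \<Rightarrow>
    ('g \<Rightarrow> 'g \<Rightarrow> 'g \<Rightarrow> 'v) \<Rightarrow> ('v \<Rightarrow> 'g) \<Rightarrow> (('g \<times> 'g) \<Rightarrow>\<^sub>0 'k) set \<Rightarrow> 'v \<Rightarrow> 'g"
  where "delta_T sg br sv \<rho> \<Phi> T X v =
    T (rho_ext sv \<rho> X v) - ad_ext sg br X (T v) + T (Phi_ext sv \<Phi> X (T v))"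

definition cocycles2 ::
  "('k::field \<Rightarrow> 'g::ab_group_add \<Rightarrow> 'g) \<Rightarrow> ('g \<Rightarrow> 'g \<Rightarrow> 'g \<Rightarrow> 'g) \<Rightarrow>
    ('k \<Rightarrow> 'v::ab_group_add \<Rightarrow> 'v) \<Rightarrow> ('g \<Rightarrow> 'g \<Rightarrow> 'v \<Rightarrow> 'v) \<Rightarrow>
    ('g \<Rightarrow> 'g \<Rightarrow> 'g \<Rightarrow> 'v) \<Rightarrow> ('v \<Rightarrow> 'g) \<Rightarrow> ('v \<Rightarrow> 'g) set"
  where "cocycles2 sg br sv \<rho> \<Phi> T =
    {f. Vector_Spaces.linear sv sg f \<and> (\<forall>u v w. d_T br \<rho> \<Phi> T f u v w = 0)}"

definition coboundaries2 ::
  "('k::field \<Rightarrow> 'g::ab_group_add \<Rightarrow> 'g) \<Rightarrow> ('g \<Rightarrow> 'g \<Rightarrow> 'g \<Rightarrow> 'g) \<Rightarrow>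
    ('k \<Rightarrow> 'v::ab_group_add \<Rightarrow> 'v) \<Rightarrow> ('g \<Rightarrow> 'g \<Rightarrow> 'v \<Rightarrow> 'v) \<Rightarrow>
    ('g \<Rightarrow> 'g \<Rightarrow> 'g \<Rightarrow> 'v) \<Rightarrow> ('v \<Rightarrow> 'g) \<Rightarrow> ('v \<Rightarrow> 'g) set"
  where "coboundaries2 sg br sv \<rho> \<Phi> T = delta_T sg br sv \<rho> \<Phi> T ` ext2 sg"

definition H2 ::
  "('k::field \<Rightarrow> 'g::ab_group_add \<Rightarrow> 'g) \<Rightarrow> ('g \<Rightarrow> 'g \<Rightarrow> 'g \<Rightarrow> 'g) \<Rightarrow>
    ('k \<Rightarrow> 'v::ab_group_add \<Rightarrow> 'v) \<Rightarrow> ('g \<Rightarrow> 'g \<Rightarrow> 'v \<Rightarrow> 'v) \<Rightarrow>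
    ('g \<Rightarrow> 'g \<Rightarrow> 'g \<Rightarrow> 'v) \<Rightarrow> ('v \<Rightarrow> 'g) \<Rightarrow> ('v \<Rightarrow> 'g) set set"
  where "H2 sg br sv \<rho> \<Phi> T =
    cocycles2 sg br sv \<rho> \<Phi> T //
      {(f, h). f \<in> cocycles2 sg br sv \<rho> \<Phi> T \<and> h \<in> cocycles2 sg br sv \<rho> \<Phi> T \<and>
         (\<lambda>v. f v - h v) \<in> coboundaries2 sg br sv \<rho> \<Phi> T}"

section \<open>Homomorphisms and deformations\<close>

definition three_lie_hom ::
  "('k::field \<Rightarrow> 'g::ab_group_add \<Rightarrow> 'g) \<Rightarrow> ('g \<Rightarrow> 'g \<Rightarrow> 'g \<Rightarrow> 'g) \<Rightarrow> ('g \<Rightarrow> 'g) \<Rightarrow> bool"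
  where "three_lie_hom sg br \<phi> \<longleftrightarrow>
    Vector_Spaces.linear sg sg \<phi> \<and> (\<forall>x y z. \<phi> (br x y z) = br (\<phi> x) (\<phi> y) (\<phi> z))"

definition twisted_rota_baxter_hom ::
  "('k::field \<Rightarrow> 'g::ab_group_add \<Rightarrow> 'g) \<Rightarrow> ('g \<Rightarrow> 'g \<Rightarrow> 'g \<Rightarrow> 'g) \<Rightarrow>
    ('k \<Rightarrow> 'v::ab_group_add \<Rightarrow> 'v) \<Rightarrow> ('g \<Rightarrow> 'g \<Rightarrow> 'v \<Rightarrow> 'v) \<Rightarrow>
    ('g \<Rightarrow> 'g \<Rightarrow> 'g \<Rightarrow> 'v) \<Rightarrow> ('v \<Rightarrow> 'g) \<Rightarrow> ('v \<Rightarrow> 'g) \<Rightarrow> ('g \<Rightarrow> 'g) \<Rightarrow> ('v \<Rightarrow> 'v) \<Rightarrow> bool"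
  where "twisted_rota_baxter_hom sg br sv \<rho> \<Phi> T T' \<phi> \<psi> \<longleftrightarrow>
    three_lie_hom sg br \<phi> \<and> Vector_Spaces.linear sv sv \<psi> \<and>
    \<phi> \<circ> T = T' \<circ> \<psi> \<and>
    (\<forall>x y u. \<psi> (\<rho> x y u) = \<rho> (\<phi> x) (\<phi> y) (\<psi> u)) \<and>
    (\<forall>x y z. \<psi> (\<Phi> x y z) = \<Phi> (\<phi> x) (\<phi> y) (\<phi> z))"

definition deform ::
  "('k::field \<Rightarrow> 'g::ab_group_add \<Rightarrow> 'g) \<Rightarrow> ('v \<Rightarrow> 'g) \<Rightarrow> ('v \<Rightarrow> 'g) \<Rightarrow> 'k \<Rightarrow> 'v \<Rightarrow> 'g"
  where "deform sg T S t v = T v + sg t (S v)"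

definition infinitesimal_deformation ::
  "('k::field \<Rightarrow> 'g::ab_group_add \<Rightarrow> 'g) \<Rightarrow> ('g \<Rightarrow> 'g \<Rightarrow> 'g \<Rightarrow> 'g) \<Rightarrow>
    ('k \<Rightarrow> 'v::ab_group_add \<Rightarrow> 'v) \<Rightarrow> ('g \<Rightarrow> 'g \<Rightarrow> 'v \<Rightarrow> 'v) \<Rightarrow>
    ('g \<Rightarrow> 'g \<Rightarrow> 'g \<Rightarrow> 'v) \<Rightarrow> ('v \<Rightarrow> 'g) \<Rightarrow> ('v \<Rightarrow> 'g) \<Rightarrow> bool"
  where "infinitesimal_deformation sg br sv \<rho> \<Phi> T S \<longleftrightarrow>
    Vector_Spaces.linear sv sg S \<and> (\<forall>t. twisted_rota_baxter sg br sv \<rho> \<Phi> (deform sg T S t))"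

definition equivalent_deformations ::
  "('k::field \<Rightarrow> 'g::ab_group_add \<Rightarrow> 'g) \<Rightarrow> ('g \<Rightarrow> 'g \<Rightarrow> 'g \<Rightarrow> 'g) \<Rightarrow>
    ('k \<Rightarrow> 'v::ab_group_add \<Rightarrow> 'v) \<Rightarrow> ('g \<Rightarrow> 'g \<Rightarrow> 'v \<Rightarrow> 'v) \<Rightarrow>
    ('g \<Rightarrow> 'g \<Rightarrow> 'g \<Rightarrow> 'v) \<Rightarrow> ('v \<Rightarrow> 'g) \<Rightarrow> ('v \<Rightarrow> 'g) \<Rightarrow> ('v \<Rightarrow> 'g) \<Rightarrow> bool"
  where "equivalent_deformations sg br sv \<rho> \<Phi> T S1 S2 \<longleftrightarrow>
    (\<exists>X\<in>ext2 sg. \<forall>t.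
       twisted_rota_baxter_hom sg br sv \<rho> \<Phi> (deform sg T S1 t) (deform sg T S2 t)
         (\<lambda>x. x + sg t (ad_ext sg br X x))
         (\<lambda>v. v + sv t (rho_ext sv \<rho> X v) + sv t (Phi_ext sv \<Phi> X (T v))))"

text \<open>
  The operator equation for \<open>T + t S\<close> is polynomial in \<open>t\<close> of degree at most 4, with \<open>d_T S\<close>
  as coefficient of \<open>t\<close>. As \<open>t\<close> ranges over the field, its validity forces \<open>d_T S = 0\<close>
  unless the field has three elements. Over that field \<open>S\<close> need not be a cocycle, for instance
  with \<open>\<rho> = 0\<close>, \<open>\<Phi> = 0\<close>, \<open>V = K\<^sup>3\<close> and the 3-Lie algebra \<open>K\<^sup>3\<close> with \<open>[e1, e2, e3] = e1\<close>,
  \<open>T = diag(0, -1, 1)\<close>, \<open>S = id\<close>: there \<open>[T\<^sub>t u, T\<^sub>t v, T\<^sub>t w]\<close> is a multiple of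
  \<open>det (T + t S) = t\<^sup>3 - t = 0\<close>. So for a field with three elements being in the same class can
  only mean that the difference is a coboundary; for all other fields both operators lie in
  a common element of \<open>H2\<close>.
\<close>

definition same_cohomology_class ::
  "('k::field \<Rightarrow> 'g::ab_group_add \<Rightarrow> 'g) \<Rightarrow> ('g \<Rightarrow> 'g \<Rightarrow> 'g \<Rightarrow> 'g) \<Rightarrow>
    ('k \<Rightarrow> 'v::ab_group_add \<Rightarrow> 'v) \<Rightarrow> ('g \<Rightarrow> 'g \<Rightarrow> 'v \<Rightarrow> 'v) \<Rightarrow>
    ('g \<Rightarrow> 'g \<Rightarrow> 'g \<Rightarrow> 'v) \<Rightarrow> ('v \<Rightarrow> 'g) \<Rightarrow> ('v \<Rightarrow> 'g) \<Rightarrow> ('v \<Rightarrow> 'g) \<Rightarrow> bool"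
  where "same_cohomology_class sg br sv \<rho> \<Phi> T S1 S2 \<longleftrightarrow>
    (\<exists>c\<in>H2 sg br sv \<rho> \<Phi> T. S1 \<in> c \<and> S2 \<in> c)"

end

theory Submission
  imports Defs
begin

text \<open>
  Both claims compare coefficients of polynomials in \<open>t\<close> that vanish on the whole field.
  The intertwining condition of the equivalence has the form \<open>t a + t\<^sup>2 b = 0\<close> with
  \<open>a = \<TT>\<^sub>1 - \<TT>\<^sub>2 - \<delta>(\<XX>)\<close>, and \<open>t = 1, -1\<close> give \<open>a = 0\<close>. The operator equation of
  \<open>T + t \<TT>\<close> has the form \<open>t c\<^sub>1 + t\<^sup>2 c\<^sub>2 + t\<^sup>3 c\<^sub>3 + t\<^sup>4 c\<^sub>4 = 0\<close> with \<open>c\<^sub>1 = d\<^sub>T \<TT>\<close>; its odd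
  part \<open>t c\<^sub>1 + t\<^sup>3 c\<^sub>3\<close> vanishes as well, so \<open>c\<^sub>1 = 0\<close> as soon as the field has an element
  other than \<open>0, 1, -1\<close>.
\<close>

lemma two_neq_0_if_CHAR_neq_2:
  assumes "CHAR('k::field) \<noteq> 2"
  shows "(2::'k) \<noteq> 0"
proof
  assume "(2::'k) = 0"
  then have "CHAR('k) dvd 2"
    using of_nat_eq_0_iff_char_dvd[where 'a='k, of 2] by simp
  then show False
    using assms by (metis CHAR_not_1' One_nat_def prime_nat_iff two_is_prime_nat)
qed

context vector_space
begin

lemma eq_0_if_eq_uminus:
  fixes x :: 'b
  assumes "CHAR('a) \<noteq> 2" and "x = - x"
  shows "x = 0"
proof -
  have "scale 2 x = 0"
    using assms(2) by (metis scale_left_distrib scale_one eq_neg_iff_add_eq_0 one_add_one)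
  then show ?thesis
    using two_neq_0_if_CHAR_neq_2[OF assms(1)] by simp
qed

text \<open>The values \<open>1\<close> and \<open>-1\<close> exist in every field, and they give
  \<open>a = -b\<close> and \<open>a = b\<close>. The argument therefore covers the field with three
  elements, so the coboundary claim holds there too.\<close>

lemma linear_coeff_eq_0_if_quadratic:
  assumes "CHAR('a) \<noteq> 2" and "\<And>t. scale t a + scale (t\<^sup>2) b = 0"
  shows "a = 0"
proof (rule eq_0_if_eq_uminus[OF assms(1)])
  show "a = - a"
    using assms(2)[of 1] assms(2)[of "- 1"] by (simp add: add_eq_0_iff)
qed

lemma linear_coeff_eq_0_if_quartic:
  assumes char: "CHAR('a) \<noteq> 2" and card: "card (UNIV :: 'a set) \<noteq> 3"
    and zero: "\<And>t. scale t c1 + scale (t\<^sup>2) c2 + scale (t ^ 3) c3 + scale (t ^ 4) c4 = 0"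
  shows "c1 = 0"
proof -
  \<comment> \<open>Replacing \<open>t\<close> by \<open>-t\<close> fixes the even terms and negates
    the odd ones, so the odd part and its negative both equal minus the even part.\<close>
  have odd: "scale t c1 + scale (t ^ 3) c3 = 0" for t
  proof (rule eq_0_if_eq_uminus[OF char])
    have "scale t c1 + scale (t ^ 3) c3 = - (scale (t\<^sup>2) c2 + scale (t ^ 4) c4)"
      using zero[of t] by (simp add: eq_neg_iff_add_eq_0 algebra_simps)
    moreover have "- (scale t c1 + scale (t ^ 3) c3) = - (scale (t\<^sup>2) c2 + scale (t ^ 4) c4)"
      using zero[of "- t"] by (simp add: eq_neg_iff_add_eq_0 algebra_simps)
    ultimately show "scale t c1 + scale (t ^ 3) c3 = - (scale t c1 + scale (t ^ 3) c3)"
      by simp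
  qed
  have "(1::'a) \<noteq> - 1"
    using two_neq_0_if_CHAR_neq_2[OF char] by (metis add.right_inverse one_add_one)
  then have "card {0, 1, - 1 :: 'a} = 3"
    by simp
  \<comment> \<open>An infinite type has \<open>card\<close> 0, so \<open>card\<close> different
    from 3 admits infinite fields as well; either way \<open>{0, 1, - 1}\<close> is not the whole
    field.\<close>
  then obtain t :: 'a where t: "t \<notin> {0, 1, - 1}"
    using card by (metis UNIV_eq_I)
  have c3: "c3 = - c1"
    using odd[of 1] by (simp add: add_eq_0_iff)
  have "scale (t * (1 - t\<^sup>2)) c1 = 0"
    using odd[of t] by (simp add: c3 algebra_simps power2_eq_square power3_eq_cube)
  \<comment> \<open>The roots of this cubic are exactly \<open>0\<close>, \<open>1\<close> and
    \<open>-1\<close>. On the field with three elements it vanishes identically, which is why that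
    field is excluded.\<close>
  moreover have "t * (1 - t\<^sup>2) \<noteq> 0"
    using t power2_eq_1_iff[of t] by auto
  ultimately show ?thesis
    by simp
qed

end

lemma skew_bilinear_simps:
  assumes "skew_bilinear s s' B"
  shows "B (x + x') y = B x y + B x' y" "B x (y + y') = B x y + B x y'"
    "B (s c x) y = s' c (B x y)" "B x (s c y) = s' c (B x y)"
proof -
  have l: "module_hom s s' (\<lambda>x. B x y)" and r: "module_hom s s' (B x)" for x y
    using assms unfolding skew_bilinear_def Vector_Spaces.linear_def by blast+
  show "B (x + x') y = B x y + B x' y" "B x (y + y') = B x y + B x y'"
    "B (s c x) y = s' c (B x y)" "B x (s c y) = s' c (B x y)"
    by (fact module_hom.add[OF l] module_hom.add[OF r] module_hom.scale[OF l] module_hom.scale[OF r])+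
qed

lemma skew_trilinear_imp_skew_bilinear:
  assumes "skew_trilinear s s' F"
  shows "skew_bilinear s s' (\<lambda>x y. F x y z)"
  using assms unfolding skew_trilinear_def skew_bilinear_def by blast

lemma skew_trilinear_simps:
  assumes "skew_trilinear s s' F"
  shows "F (x + x') y z = F x y z + F x' y z" "F x (y + y') z = F x y z + F x y' z"
    "F x y (z + z') = F x y z + F x y z'"
    "F (s c x) y z = s' c (F x y z)" "F x (s c y) z = s' c (F x y z)"
    "F x y (s c z) = s' c (F x y z)"
proof -
  have r: "module_hom s s' (F x y)" for x y
    using assms unfolding skew_trilinear_def Vector_Spaces.linear_def by blast
  show "F x y (z + z') = F x y z + F x y z'" "F x y (s c z) = s' c (F x y z)"
    by (fact module_hom.add[OF r] module_hom.scale[OF r])+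
qed (fact skew_bilinear_simps[OF skew_trilinear_imp_skew_bilinear[OF assms]])+

lemma skew_trilinear_rotate:
  assumes "skew_trilinear s s' F"
  shows "F y z x = F x y z"
  using assms unfolding skew_trilinear_def by (metis minus_minus)

text \<open>The coefficient of \<open>t\<close> is written with cyclically rotated arguments, which
  is legitimate because rotations are even permutations. In this form it matches the cyclic sum in
  \<open>d_T\<close>.\<close>

lemma skew_trilinear_expand:
  assumes F: "skew_trilinear s s' F"
  shows "F (x + s t x') (y + s t y') (z + s t z') =
    F x y z + s' t (F x y z' + F y z x' + F z x y')
    + s' (t\<^sup>2) (F x y' z' + F x' y z' + F x' y' z) + s' (t ^ 3) (F x' y' z')"
proof -
  interpret vector_space s'
    using F unfolding skew_trilinear_def Vector_Spaces.linear_def by blast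
  have "F y z x' = F x' y z" "F z x y' = F x y' z"
    by (fact skew_trilinear_rotate[OF F] skew_trilinear_rotate[OF F, symmetric])+
  then show ?thesis
    by (simp add: skew_trilinear_simps[OF F] algebra_simps power2_eq_square power3_eq_cube)
qed

lemma wedge_in_ext2: "wedge sg x y \<in> ext2 sg"
  by (simp add: wedge_def ext2_def quotientI)

text \<open>The zero map is the image of \<open>wedge sg 0 0\<close> under \<open>delta_T\<close>,
  since every bilinear map vanishes at \<open>(0, 0)\<close>. This makes the relation that defines
  \<open>H2\<close> reflexive on cocycles.\<close>

lemma (in three_lie_representation) zero_in_coboundaries2:
  assumes char: "CHAR('k) \<noteq> 2" and \<Phi>: "skew_trilinear sg sv \<Phi>"
    and T: "Vector_Spaces.linear sv sg T"
  shows "(\<lambda>v. 0) \<in> coboundaries2 sg br sv \<rho> \<Phi> T"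
proof -
  interpret T: Vector_Spaces.linear sv sg T by fact
  have zero: "ext2_lift s B (wedge sg 0 0) = 0"
    if "vector_space s" "skew_bilinear sg s B" for s :: "'k \<Rightarrow> 'w::ab_group_add \<Rightarrow> 'w" and B
    using ext2_lift_wedge[OF char that, of 0 0] skew_bilinear_simps(1)[OF that(2), of 0 0 0]
    by simp
  have "delta_T sg br sv \<rho> \<Phi> T (wedge sg 0 0) v = 0" for v
    unfolding delta_T_def rho_ext_def ad_ext_def Phi_ext_def
    by (simp add: zero[OF V.vector_space_axioms rho_skew_bilinear]
        zero[OF vector_space_axioms skew_trilinear_imp_skew_bilinear[OF skew_trilinear_bracket]]
        zero[OF V.vector_space_axioms skew_trilinear_imp_skew_bilinear[OF \<Phi>]])
  then show ?thesis
    unfolding coboundaries2_def using wedge_in_ext2 by (force intro!: image_eqI)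
qed

lemma (in three_lie_representation) infinitesimal_deformation_imp_cocycle:
  assumes char: "CHAR('k) \<noteq> 2" and card: "card (UNIV :: 'k set) \<noteq> 3"
    and \<Phi>: "skew_trilinear sg sv \<Phi>"
    and T: "twisted_rota_baxter sg br sv \<rho> \<Phi> T"
    and S: "infinitesimal_deformation sg br sv \<rho> \<Phi> T S"
  shows "S \<in> cocycles2 sg br sv \<rho> \<Phi> T"
proof -
  interpret T: Vector_Spaces.linear sv sg T
    using T unfolding twisted_rota_baxter_def by blast
  interpret S: Vector_Spaces.linear sv sg S
    using S unfolding infinitesimal_deformation_def by blast
  note \<rho>_simps = skew_bilinear_simps[OF rho_skew_bilinear]
  have \<rho>_lin: "module_hom sv sv (\<rho> x y)" for x y
    using rho_linear unfolding Vector_Spaces.linear_def by blast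
  have "d_T br \<rho> \<Phi> T S u v w = 0" for u v w
  proof (rule linear_coeff_eq_0_if_quartic[OF char card])
    fix t
    \<comment> \<open>The \<open>b\<close>s are the coefficients in \<open>t\<close> of the bracket
      induced by \<open>T + t S\<close>, the \<open>a\<close>s those of \<open>br\<close> on its
      values. The constant coefficient of the latter is \<open>T b0\<close>, because
      \<open>T\<close> satisfies the operator equation.\<close>
    define b0 where "b0 = bracket_T \<rho> \<Phi> T u v w"
    define b1 where "b1 =
      \<rho> (T u) (S v) w + \<rho> (S u) (T v) w + \<rho> (T v) (S w) u + \<rho> (S v) (T w) u
      + \<rho> (T w) (S u) v + \<rho> (S w) (T u) v
      + (\<Phi> (T u) (T v) (S w) + \<Phi> (T v) (T w) (S u) + \<Phi> (T w) (T u) (S v))"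
    define b2 where "b2 = \<rho> (S u) (S v) w + \<rho> (S v) (S w) u + \<rho> (S w) (S u) v
      + (\<Phi> (T u) (S v) (S w) + \<Phi> (S u) (T v) (S w) + \<Phi> (S u) (S v) (T w))"
    define b3 where "b3 = \<Phi> (S u) (S v) (S w)"
    define a1 where "a1 = br (T u) (T v) (S w) + br (T v) (T w) (S u) + br (T w) (T u) (S v)"
    define a2 where "a2 = br (T u) (S v) (S w) + br (S u) (T v) (S w) + br (S u) (S v) (T w)"
    define a3 where "a3 = br (S u) (S v) (S w)"
    have d: "d_T br \<rho> \<Phi> T S u v w = a1 - T b1 - S b0"
      by (simp add: d_T_def varrho_T_def a1_def b1_def b0_def T.add algebra_simps)
    have b: "bracket_T \<rho> \<Phi> (deform sg T S t) u v w =
        b0 + sv t b1 + sv (t\<^sup>2) b2 + sv (t ^ 3) b3"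
      unfolding bracket_T_def deform_def skew_trilinear_expand[OF \<Phi>] b0_def b1_def b2_def b3_def
      by (simp add: \<rho>_simps V.scale_right_distrib algebra_simps power2_eq_square)
    have a: "br (deform sg T S t u) (deform sg T S t v) (deform sg T S t w) =
        T b0 + sg t a1 + sg (t\<^sup>2) a2 + sg (t ^ 3) a3"
      using T unfolding deform_def skew_trilinear_expand[OF skew_trilinear_bracket]
        twisted_rota_baxter_def a1_def a2_def a3_def b0_def by simp
    have "br (deform sg T S t u) (deform sg T S t v) (deform sg T S t w) =
        deform sg T S t (bracket_T \<rho> \<Phi> (deform sg T S t) u v w)"
      using S unfolding infinitesimal_deformation_def twisted_rota_baxter_def by blast
    \<comment> \<open>The constant terms \<open>T b0\<close> cancel. Degree 4 arises when the outer
      \<open>t S\<close> meets the cubic term \<open>b3\<close> contributed by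
      \<open>\<Phi>\<close>.\<close>
    then show "sg t (d_T br \<rho> \<Phi> T S u v w) + sg (t\<^sup>2) (a2 - T b2 - S b1)
        + sg (t ^ 3) (a3 - T b3 - S b2) + sg (t ^ 4) (- S b3) = 0"
      unfolding a b d
      by (simp add: deform_def T.add T.scale S.add S.scale algebra_simps
          power2_eq_square power3_eq_cube power4_eq_xxxx)
  qed
  then show ?thesis
    unfolding cocycles2_def using S unfolding infinitesimal_deformation_def by blast
qed

text \<open>The element \<open>X\<close> that realises the equivalence is itself the preimage:
  \<open>S1 - S2\<close> equals \<open>delta_T\<close> of \<open>X\<close>.\<close>

lemma (in three_lie_representation) equivalent_deformations_imp_coboundary:
  assumes char: "CHAR('k) \<noteq> 2"
    and T: "Vector_Spaces.linear sv sg T" and S2: "Vector_Spaces.linear sv sg S2"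
    and equiv: "equivalent_deformations sg br sv \<rho> \<Phi> T S1 S2"
  shows "(\<lambda>v. S1 v - S2 v) \<in> coboundaries2 sg br sv \<rho> \<Phi> T"
proof -
  interpret T: Vector_Spaces.linear sv sg T by fact
  interpret S2: Vector_Spaces.linear sv sg S2 by fact
  from equiv obtain X where X: "X \<in> ext2 sg"
    and hom: "\<And>t. twisted_rota_baxter_hom sg br sv \<rho> \<Phi> (deform sg T S1 t) (deform sg T S2 t)
         (\<lambda>x. x + sg t (ad_ext sg br X x))
         (\<lambda>v. v + sv t (rho_ext sv \<rho> X v) + sv t (Phi_ext sv \<Phi> X (T v)))"
    unfolding equivalent_deformations_def by blast
  define ad where "ad = ad_ext sg br X"
  define \<psi> where "\<psi> v = rho_ext sv \<rho> X v + Phi_ext sv \<Phi> X (T v)" for v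
  \<comment> \<open>Linearity of \<open>ad\<close> is read off from the homomorphism at
    \<open>t = 1\<close> by subtracting the identity, which avoids working with representatives of
    \<open>X\<close>.\<close>
  have "module_hom sg sg (\<lambda>x. x + ad x)"
    using hom[of 1]
    by (simp add: twisted_rota_baxter_hom_def three_lie_hom_def Vector_Spaces.linear_def ad_def)
  from module_hom.add[OF this] module_hom.scale[OF this]
  have ad_add: "ad (x + y) = ad x + ad y" and ad_scale: "ad (sg t x) = sg t (ad x)" for x y t
    by (simp_all add: algebra_simps)
  have "S1 v - S2 v - delta_T sg br sv \<rho> \<Phi> T X v = 0" for v
  proof (rule linear_coeff_eq_0_if_quadratic[OF char])
    fix t
    have "deform sg T S1 t v + sg t (ad (deform sg T S1 t v)) = deform sg T S2 t (v + sv t (\<psi> v))"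
      using hom[of t]
      by (simp add: twisted_rota_baxter_hom_def fun_eq_iff ad_def \<psi>_def V.scale_right_distrib
          add.assoc)
    then show "sg t (S1 v - S2 v - delta_T sg br sv \<rho> \<Phi> T X v)
        + sg (t\<^sup>2) (ad (S1 v) - S2 (\<psi> v)) = 0"
      by (simp add: deform_def delta_T_def ad_add ad_scale T.add T.scale S2.add S2.scale
          \<psi>_def ad_def[symmetric] algebra_simps power2_eq_square)
  qed
  then show ?thesis
    unfolding coboundaries2_def using X by (auto intro!: image_eqI[of _ _ X])
qed

theorem theorem2p20:
  fixes sg :: "'k::field \<Rightarrow> 'g::ab_group_add \<Rightarrow> 'g"
    and br :: "'g \<Rightarrow> 'g \<Rightarrow> 'g \<Rightarrow> 'g"
    and sv :: "'k \<Rightarrow> 'v::ab_group_add \<Rightarrow> 'v"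
    and \<rho> :: "'g \<Rightarrow> 'g \<Rightarrow> 'v \<Rightarrow> 'v"
    and \<Phi> :: "'g \<Rightarrow> 'g \<Rightarrow> 'g \<Rightarrow> 'v"
    and T S1 S2 :: "'v \<Rightarrow> 'g"
  assumes "CHAR('k) \<noteq> 2"
    and "three_lie_algebra sg br"
    and "three_lie_representation sg br sv \<rho>"
    and "two_cocycle sg br sv \<rho> \<Phi>"
    and "twisted_rota_baxter sg br sv \<rho> \<Phi> T"
    and "infinitesimal_deformation sg br sv \<rho> \<Phi> T S1"
    and "infinitesimal_deformation sg br sv \<rho> \<Phi> T S2"
    and "equivalent_deformations sg br sv \<rho> \<Phi> T S1 S2"
  shows "(\<lambda>v. S1 v - S2 v) \<in> coboundaries2 sg br sv \<rho> \<Phi> T \<and>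
    (card (UNIV :: 'k set) \<noteq> 3 \<longrightarrow> same_cohomology_class sg br sv \<rho> \<Phi> T S1 S2)"
proof -
  interpret three_lie_representation sg br sv \<rho> by fact
  have \<Phi>: "skew_trilinear sg sv \<Phi>"
    using assms(4) unfolding two_cocycle_def by blast
  have T: "Vector_Spaces.linear sv sg T"
    using assms(5) unfolding twisted_rota_baxter_def by blast
  have S2: "Vector_Spaces.linear sv sg S2"
    using assms(7) unfolding infinitesimal_deformation_def by blast
  have diff: "(\<lambda>v. S1 v - S2 v) \<in> coboundaries2 sg br sv \<rho> \<Phi> T"
    by (rule equivalent_deformations_imp_coboundary) fact+
  have "same_cohomology_class sg br sv \<rho> \<Phi> T S1 S2" if card: "card (UNIV :: 'k set) \<noteq> 3"
  proof -
    \<comment> \<open>The common element of \<open>H2\<close> is the class of \<open>S1\<close>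
      under \<open>R\<close>: it contains \<open>S1\<close> because zero is a coboundary, and
      \<open>S2\<close> by \<open>diff\<close>.\<close>
    define R where "R = {(f, h). f \<in> cocycles2 sg br sv \<rho> \<Phi> T \<and> h \<in> cocycles2 sg br sv \<rho> \<Phi> T \<and>
       (\<lambda>v. f v - h v) \<in> coboundaries2 sg br sv \<rho> \<Phi> T}"
    have S1_cocycle: "S1 \<in> cocycles2 sg br sv \<rho> \<Phi> T" and "S2 \<in> cocycles2 sg br sv \<rho> \<Phi> T"
      using infinitesimal_deformation_imp_cocycle[OF assms(1) card \<Phi> assms(5)] assms(6,7)
      by blast+
    then have "S1 \<in> R `` {S1}" "S2 \<in> R `` {S1}"
      using diff zero_in_coboundaries2[OF assms(1) \<Phi> T] by (simp_all add: R_def)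
    moreover have "R `` {S1} \<in> H2 sg br sv \<rho> \<Phi> T"
      unfolding H2_def R_def[symmetric] using S1_cocycle by (rule quotientI)
    ultimately show ?thesis
      unfolding same_cohomology_class_def by blast
  qed
  with diff show ?thesis
    by blast
qed

end
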